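(* Let $(I,f)$, $f=f_{\mu,\pi}$, be a $d$-IET with $I_d\neq f(I_{\pi^{-1}(d)})$ that has a continuous embedding by $h$ into a $d$-PWI $(X,T)$. Then $(I',\mathcal{R}(f))$ has a continuous embedding by $h$ (restricted to $I'$) into $(X',\mathcal{S}(T))$.
   Context: IETs. Let $d\ge 2$, let $\pi$ be an irreducible permutation of $\{1,\dots,d\}$ (i.e. $\pi(\{1,\dots,k\})\ne\{1,\dots,k\}$ for $1\le k<d$), and let $\mu=(\mu_1,\dots,\mu_d)$ have positive real entries. Put $x_0=0$, $x_j=\sum_{k=1}^j\mu_k$, $I=[x_0,x_d)$, $I_j=[x_{j-1},x_j)$, and $\tau_j=\sum_{\pi(k)<\pi(j)}\mu_k-\sum_{k<j}\mu_k$. The $d$-IET $(I,f)$, $f=f_{\mu,\pi}:I\to I$, is the bijection $f(x)=x+\tau_j$ for $x\in I_j$. PWIs. A $d$-PWI $(X,T)$ consists of a set $X\subset\mathbb{C}$, a partition of $X$ into pairwise disjoint convex sets (atoms) $X_1,\dots,X_d$, and a map $T:X\to\mathbb{C}$ with $T(z)=e^{i\theta_j}z+\lambda_j$ for $z\in X_j$, where $\theta_j\in[0,2\pi)$, $\lambda_j\in\mathbb{C}$. (Points of $X$ may leave $X$ under $T$.) Embeddings. An injective map $h:I\to X$ is a piecewise continuous embedding of $(I,f)$ into $(X,T)$ if $h(I)$ is an invariant set for $(X,T)$, $h|_{I_j}$ is a homeomorphism onto its image and $h(I_j)\subset X_j$ for each $j$, and $h\circ f(x)=T\circ h(x)$ for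 all $x\in I$. It is a continuous embedding if moreover $h$ is continuous on $I$. Rauzy-Veech induction. When $I_d\ne f(I_{\pi^{-1}(d)})$, $f$ has type $0$ if $f(I_{\pi^{-1}(d)})\subset I_d$ and type $1$ if $I_d\subset f(I_{\pi^{-1}(d)})$. Let $I'=I\setminus f(I_{\pi^{-1}(d)})$ if $f$ has type $0$ and $I'=I\setminus I_d$ if $f$ has type $1$. $\mathcal{R}(f)$ is the first return map of $f$ to $I'$; it is again a $d$-IET, with intervals $I'_j$ given as follows. Type $0$: $I'_j=I_j$ for $j\ne d$, $I'_d=I_d\setminus f(I_{\pi^{-1}(d)})$. Type $1$: $I'_j=I_j$ for $1\le j<\pi^{-1}(d)$, $I'_{\pi^{-1}(d)}=I_{\pi^{-1}(d)}\setminus f^{-1}(I_d)$, $I'_{\pi^{-1}(d)+1}=f^{-1}(I_d)$, $I'_j=I_{j-1}$ for $\pi^{-1}(d)+1<j\le d$. Induction for PWIs. $\mathcal{S}(T)$ is the first return map under $T$ to $X'$, where $X'=\bigcup_{j=1}^{d-1}X_j\cup\left(X_d\setminus T(X_{\pi^{-1}(d)})\right)$ if $f$ has type $0$ and $X'=\bigcup_{j=1}^{d-1}X_j$ if $f$ has type $1$. $(X',\mathcal{S}(T))$ is regarded as a $d'$-PWI, where possibly $d'\ne d$, with atoms the pieces of $X'$ determined by the itinerary through $X_1,\dots,X_d$ up to the first return; embedding into it means that $h|_{I'}$ is injective and continuous, is a homeomorphism of each $I'_j$ onto its image lying in one atom, that $h(I')\subset X'$ is invariant under $\mathcal{S}(T)$,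 and that $h\circ\mathcal{R}(f)(x)=\mathcal{S}(T)\circ h(x)$ for all $x\in I'$. *)

theory Defs
  imports "HOL-Analysis.Analysis" "HOL-Combinatorics.Permutations"
begin

subsection \<open>Interval exchange transformations\<close>

definition irreducible_perm :: "nat \<Rightarrow> (nat \<Rightarrow> nat) \<Rightarrow> bool" where
  "irreducible_perm d \<pi> \<longleftrightarrow>
     \<pi> permutes {1..d} \<and> (\<forall>k. 1 \<le> k \<and> k < d \<longrightarrow> \<pi> ` {1..k} \<noteq> {1..k})"

definition iet_data :: "nat \<Rightarrow> (nat \<Rightarrow> real) \<Rightarrow> (nat \<Rightarrow> nat) \<Rightarrow> bool" where
  "iet_data d \<mu> \<pi> \<longleftrightarrow> 2 \<le> d \<and> irreducible_perm d \<pi> \<and> (\<forall>j\<in>{1..d}. 0 < \<mu> j)"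

definition iet_point :: "(nat \<Rightarrow> real) \<Rightarrow> nat \<Rightarrow> real" where
  "iet_point \<mu> j = (\<Sum>k=1..j. \<mu> k)"

definition iet_dom :: "nat \<Rightarrow> (nat \<Rightarrow> real) \<Rightarrow> real set" where
  "iet_dom d \<mu> = {iet_point \<mu> 0..<iet_point \<mu> d}"

definition iet_int :: "(nat \<Rightarrow> real) \<Rightarrow> nat \<Rightarrow> real set" where
  "iet_int \<mu> j = {iet_point \<mu> (j - 1)..<iet_point \<mu> j}"

definition iet_shift :: "nat \<Rightarrow> (nat \<Rightarrow> real) \<Rightarrow> (nat \<Rightarrow> nat) \<Rightarrow> nat \<Rightarrow> real" where
  "iet_shift d \<mu> \<pi> j =
     (\<Sum>k | k \<in> {1..d} \<and> \<pi> k < \<pi> j. \<mu> k) - (\<Sum>k | k \<in> {1..d} \<and> k < j. \<mu> k)"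

(* Only the values on iet_dom d \<mu> are meaningful; there the index is unique. *)
definition iet_map :: "nat \<Rightarrow> (nat \<Rightarrow> real) \<Rightarrow> (nat \<Rightarrow> nat) \<Rightarrow> real \<Rightarrow> real" where
  "iet_map d \<mu> \<pi> x = x + iet_shift d \<mu> \<pi> (THE j. j \<in> {1..d} \<and> x \<in> iet_int \<mu> j)"

subsection \<open>Piecewise isometries\<close>

(* T is a total function in HOL, but only its restriction to X belongs to the system;
   T z may lie outside X. *)
definition pwi :: "nat \<Rightarrow> complex set \<Rightarrow> (nat \<Rightarrow> complex set) \<Rightarrow> (complex \<Rightarrow> complex) \<Rightarrow> bool" where
  "pwi d X Xs T \<longleftrightarrow>
     (\<Union>j\<in>{1..d}. Xs j) = X \<and>
     disjoint_family_on Xs {1..d} \<and>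
     (\<forall>j\<in>{1..d}. Xs j \<noteq> {} \<and> convex (Xs j)) \<and>
     (\<forall>j\<in>{1..d}. \<exists>\<theta>\<in>{0..<2 * pi}. \<exists>c. \<forall>z\<in>Xs j. T z = cis \<theta> * z + c)"

subsection \<open>Embeddings\<close>

(* Invariance of Y for a map T defined on D and not assumed injective: Y coincides both
   with its image and with its full preimage.  Forward invariance of h ` I alone already
   follows from the conjugacy h \<circ> f = T \<circ> h; it does not prevent points of X outside
   h ` I from being mapped into h ` I. *)
definition invariant_set :: "'a set \<Rightarrow> ('a \<Rightarrow> 'a) \<Rightarrow> 'a set \<Rightarrow> bool" where
  "invariant_set D T Y \<longleftrightarrow> T ` Y = Y \<and> {z \<in> D. T z \<in> Y} = Y"

(* The system (J, g) has intervals Js 1, ..., Js d; the map S is defined on Y, and Ys j is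
   the atom that receives h ` Js j. *)
definition pw_cont_embedding ::
  "nat \<Rightarrow> real set \<Rightarrow> (nat \<Rightarrow> real set) \<Rightarrow> (real \<Rightarrow> real) \<Rightarrow>
   complex set \<Rightarrow> (nat \<Rightarrow> complex set) \<Rightarrow> (complex \<Rightarrow> complex) \<Rightarrow> (real \<Rightarrow> complex) \<Rightarrow> bool" where
  "pw_cont_embedding d J Js g Y Ys S h \<longleftrightarrow>
     inj_on h J \<and> h ` J \<subseteq> Y \<and>
     invariant_set Y S (h ` J) \<and>
     (\<forall>j\<in>{1..d}. (\<exists>k. homeomorphism (Js j) (h ` Js j) h k) \<and> h ` Js j \<subseteq> Ys j) \<and>
     (\<forall>x\<in>J. h (g x) = S (h x))"

definition cont_embedding ::
  "nat \<Rightarrow> real set \<Rightarrow> (nat \<Rightarrow> real set) \<Rightarrow> (real \<Rightarrow> real) \<Rightarrow>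
   complex set \<Rightarrow> (nat \<Rightarrow> complex set) \<Rightarrow> (complex \<Rightarrow> complex) \<Rightarrow> (real \<Rightarrow> complex) \<Rightarrow> bool" where
  "cont_embedding d J Js g Y Ys S h \<longleftrightarrow>
     pw_cont_embedding d J Js g Y Ys S h \<and> continuous_on J h"

subsection \<open>First return maps\<close>

(* The orbit of z must stay in X, where T is defined, up to time n - 1. *)
definition return_at :: "'a set \<Rightarrow> ('a \<Rightarrow> 'a) \<Rightarrow> 'a set \<Rightarrow> 'a \<Rightarrow> nat \<Rightarrow> bool" where
  "return_at X T A z n \<longleftrightarrow> 0 < n \<and> (\<forall>k<n. (T ^^ k) z \<in> X) \<and> (T ^^ n) z \<in> A"

definition return_time :: "'a set \<Rightarrow> ('a \<Rightarrow> 'a) \<Rightarrow> 'a set \<Rightarrow> 'a \<Rightarrow> nat" where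
  "return_time X T A z = (LEAST n. return_at X T A z n)"

(* The points of A that return to A: the domain of the first return map. *)
definition return_dom :: "'a set \<Rightarrow> ('a \<Rightarrow> 'a) \<Rightarrow> 'a set \<Rightarrow> 'a set" where
  "return_dom X T A = {z \<in> A. \<exists>n. return_at X T A z n}"

definition first_return :: "'a set \<Rightarrow> ('a \<Rightarrow> 'a) \<Rightarrow> 'a set \<Rightarrow> 'a \<Rightarrow> 'a" where
  "first_return X T A z = (T ^^ return_time X T A z) z"

subsection \<open>Rauzy-Veech induction\<close>

abbreviation last_index :: "nat \<Rightarrow> (nat \<Rightarrow> nat) \<Rightarrow> nat" where
  "last_index d \<pi> \<equiv> inv \<pi> d"

(* The interval whose image under f is the rightmost one. *)
definition last_image :: "nat \<Rightarrow> (nat \<Rightarrow> real) \<Rightarrow> (nat \<Rightarrow> nat) \<Rightarrow> real set" where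
  "last_image d \<mu> \<pi> = iet_map d \<mu> \<pi> ` iet_int \<mu> (last_index d \<pi>)"

(* iet_int \<mu> d and last_image d \<mu> \<pi> are right-aligned intervals; hence, if they differ,
   exactly one of them contains the other, and type 1 is the negation of type 0. *)
definition rv_type0 :: "nat \<Rightarrow> (nat \<Rightarrow> real) \<Rightarrow> (nat \<Rightarrow> nat) \<Rightarrow> bool" where
  "rv_type0 d \<mu> \<pi> \<longleftrightarrow> last_image d \<mu> \<pi> \<subseteq> iet_int \<mu> d"

definition rv_dom :: "nat \<Rightarrow> (nat \<Rightarrow> real) \<Rightarrow> (nat \<Rightarrow> nat) \<Rightarrow> real set" where
  "rv_dom d \<mu> \<pi> =
     (if rv_type0 d \<mu> \<pi> then iet_dom d \<mu> - last_image d \<mu> \<pi> else iet_dom d \<mu> - iet_int \<mu> d)"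

definition rv_map :: "nat \<Rightarrow> (nat \<Rightarrow> real) \<Rightarrow> (nat \<Rightarrow> nat) \<Rightarrow> real \<Rightarrow> real" where
  "rv_map d \<mu> \<pi> = first_return (iet_dom d \<mu>) (iet_map d \<mu> \<pi>) (rv_dom d \<mu> \<pi>)"

definition rv_int :: "nat \<Rightarrow> (nat \<Rightarrow> real) \<Rightarrow> (nat \<Rightarrow> nat) \<Rightarrow> nat \<Rightarrow> real set" where
  "rv_int d \<mu> \<pi> j =
     (let a = last_index d \<pi>;
          B = {x \<in> iet_dom d \<mu>. iet_map d \<mu> \<pi> x \<in> iet_int \<mu> d}
      in if rv_type0 d \<mu> \<pi> then
           (if j = d then iet_int \<mu> d - last_image d \<mu> \<pi> else iet_int \<mu> j)
         else
           (if j < a then iet_int \<mu> j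
            else if j = a then iet_int \<mu> a - B
            else if j = a + 1 then B
            else iet_int \<mu> (j - 1)))"

subsection \<open>Induction for piecewise isometries\<close>

definition pwi_ind_set ::
  "nat \<Rightarrow> (nat \<Rightarrow> real) \<Rightarrow> (nat \<Rightarrow> nat) \<Rightarrow> (nat \<Rightarrow> complex set) \<Rightarrow> (complex \<Rightarrow> complex) \<Rightarrow> complex set" where
  "pwi_ind_set d \<mu> \<pi> Xs T =
     (if rv_type0 d \<mu> \<pi> then (\<Union>j\<in>{1..d - 1}. Xs j) \<union> (Xs d - T ` Xs (last_index d \<pi>))
      else (\<Union>j\<in>{1..d - 1}. Xs j))"

(* Points of A whose itinerary through Xs up to the first return to A is the word w. *)
definition itinerary_piece ::
  "complex set \<Rightarrow> (nat \<Rightarrow> complex set) \<Rightarrow> (complex \<Rightarrow> complex) \<Rightarrow> complex set \<Rightarrow> nat list \<Rightarrow> complex set" where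
  "itinerary_piece X Xs T A w =
     {z \<in> return_dom X T A. return_time X T A z = length w \<and> (\<forall>k<length w. (T ^^ k) z \<in> Xs (w ! k))}"

definition return_atoms ::
  "nat \<Rightarrow> complex set \<Rightarrow> (nat \<Rightarrow> complex set) \<Rightarrow> (complex \<Rightarrow> complex) \<Rightarrow> complex set \<Rightarrow> complex set set" where
  "return_atoms d X Xs T A = {itinerary_piece X Xs T A w | w. set w \<subseteq> {1..d}} - {{}}"

end

theory Submission
  imports Defs
begin

text \<open>
  The embedding \<open>h\<close> transports everything that Rauzy--Veech induction does to \<open>f\<close> into a
  statement about \<open>T\<close>, once two points are settled.

  First, \<open>h x \<in> X'\<close> holds exactly when \<open>x \<in> I'\<close> (\<open>embedding_mem_ind_set_iff\<close>).  For type 1 this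
  only says that \<open>h\<close> respects the labels of the atoms.  For type 0 it needs that
  a point of \<open>h ` I\<close> lying in \<open>T ` X\<^sub>a\<close>, where \<open>a = \<pi>\<^sup>-\<^sup>1 d\<close>, comes from \<open>f ` I\<^sub>a\<close>; this is where the
  invariance of \<open>h ` I\<close> under preimages enters.  Hence \<open>x\<close> and \<open>h x\<close> have the same return times,
  and \<open>h\<close> conjugates the first return maps; the same invariance lets one pull a whole
  excursion ending in \<open>h ` I'\<close> back into \<open>h ` I\<close>, so \<open>h ` I'\<close> inherits invariance.

  Second, the removed set \<open>H = I - I'\<close> is for either type contained in \<open>I\<^sub>d\<close> and in \<open>f ` I\<^sub>a\<close>, and
  irreducibility gives \<open>a \<noteq> d\<close>.  As \<open>f\<close> is injective, an orbit therefore never stays in \<open>H\<close> for two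
  consecutive steps: it returns to \<open>I'\<close> at time 1 or 2, and time 2 occurs only from \<open>I\<^sub>a\<close>, via \<open>I\<^sub>d\<close>.  So
  every return itinerary is \<open>[i]\<close> or \<open>[a, d]\<close>, and the intervals of the induced exchange are
  cut precisely so that the itinerary is constant on each of them, which puts its image in one
  atom.

  What remains is that \<open>f\<close> is a bijection of \<open>I\<close>, and that \<open>f ` I\<^sub>a\<close> and \<open>I\<^sub>d\<close> share their right end
  point.  Both follow from describing \<open>f\<close> as a translation of the \<open>j\<close>-th interval of the partition
  with lengths \<open>\<mu>\<close> onto the \<open>\<pi> j\<close>-th interval of the partition with lengths \<open>\<mu> \<circ> \<pi>\<^sup>-\<^sup>1\<close>.
\<close>

section \<open>Interval exchanges are bijections\<close>

lemma iet_point_0 [simp]: "iet_point \<mu> 0 = 0"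
  by (simp add: iet_point_def)

lemma iet_point_step: "1 \<le> j \<Longrightarrow> iet_point \<mu> j = iet_point \<mu> (j - 1) + \<mu> j"
  by (cases j) (simp_all add: iet_point_def)

lemma iet_point_mono:
  assumes "\<forall>j\<in>{1..d}. 0 < \<mu> j" "i \<le> j" "j \<le> d"
  shows "iet_point \<mu> i \<le> iet_point \<mu> j"
  unfolding iet_point_def using assms by (intro sum_mono2) (auto intro: less_imp_le)

lemma iet_int_nonempty:
  assumes "\<forall>j\<in>{1..d}. 0 < \<mu> j" "j \<in> {1..d}"
  shows "iet_int \<mu> j \<noteq> {}"
  using assms iet_point_step[of j \<mu>] by (auto simp: iet_int_def)

lemma UN_iet_int:
  assumes "\<forall>j\<in>{1..d}. 0 < \<mu> j"
  shows "(\<Union>j\<in>{1..d}. iet_int \<mu> j) = iet_dom d \<mu>"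
  using assms
proof (induction d)
  case (Suc d)
  have "iet_point \<mu> 0 \<le> iet_point \<mu> d" "iet_point \<mu> d \<le> iet_point \<mu> (Suc d)"
    using iet_point_mono[OF Suc.prems, of 0 d] iet_point_mono[OF Suc.prems, of d "Suc d"] by simp_all
  moreover have "(\<Union>j\<in>{1..Suc d}. iet_int \<mu> j) = iet_dom d \<mu> \<union> iet_int \<mu> (Suc d)"
    using Suc by (simp add: atLeastAtMostSuc_conv Un_commute)
  ultimately show ?case
    by (auto simp: iet_dom_def iet_int_def)
qed (simp add: iet_dom_def)

lemma iet_int_index_unique:
  assumes "\<forall>j\<in>{1..d}. 0 < \<mu> j" "i \<in> {1..d}" "j \<in> {1..d}"
    and "x \<in> iet_int \<mu> i" "x \<in> iet_int \<mu> j"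
  shows "i = j"
proof -
  have *: False if "m < n" "m \<in> {1..d}" "n \<in> {1..d}" "x \<in> iet_int \<mu> m" "x \<in> iet_int \<mu> n" for m n
  proof -
    have "iet_point \<mu> m \<le> iet_point \<mu> (n - 1)"
      using that by (intro iet_point_mono[OF assms(1)]) auto
    then show False using that by (simp add: iet_int_def)
  qed
  show ?thesis
    using *[of i j] *[of j i] assms(2-5) by (cases i j rule: linorder_cases) blast+
qed

definition image_lengths :: "(nat \<Rightarrow> real) \<Rightarrow> (nat \<Rightarrow> nat) \<Rightarrow> nat \<Rightarrow> real" where
  "image_lengths \<mu> \<pi> = \<mu> \<circ> inv \<pi>"

lemma sum_image_lengths:
  assumes "\<pi> permutes {1..d}" "m \<le> d"
  shows "(\<Sum>k | k \<in> {1..d} \<and> \<pi> k \<le> m. \<mu> k) = iet_point (image_lengths \<mu> \<pi>) m"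
  unfolding iet_point_def image_lengths_def
proof (rule sum.reindex_bij_witness[where i = "inv \<pi>" and j = \<pi>])
  fix b assume "b \<in> {1..m}"
  then have "b \<in> {1..d}" using assms(2) by auto
  then show "inv \<pi> b \<in> {k \<in> {1..d}. \<pi> k \<le> m}"
    using permutes_in_image[OF permutes_inv[OF assms(1)], of b] \<open>b \<in> {1..m}\<close>
    by (simp only: mem_Collect_eq permutes_inverses[OF assms(1)] atLeastAtMost_iff)
next
  fix k assume "k \<in> {k \<in> {1..d}. \<pi> k \<le> m}"
  then show "\<pi> k \<in> {1..m}"
    using permutes_in_image[OF assms(1), of k] by auto
qed (simp_all add: permutes_inverses[OF assms(1)])

lemma image_lengths_pos:
  assumes "\<pi> permutes {1..d}" "\<forall>j\<in>{1..d}. 0 < \<mu> j"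
  shows "\<forall>j\<in>{1..d}. 0 < image_lengths \<mu> \<pi> j"
proof
  fix j assume "j \<in> {1..d}"
  then have "inv \<pi> j \<in> {1..d}"
    by (simp only: permutes_in_image[OF permutes_inv[OF assms(1)]])
  then show "0 < image_lengths \<mu> \<pi> j" using assms(2) by (simp add: image_lengths_def)
qed

lemma iet_dom_image_lengths:
  assumes "\<pi> permutes {1..d}"
  shows "iet_dom d (image_lengths \<mu> \<pi>) = iet_dom d \<mu>"
proof -
  have "\<pi> k \<le> d" if "k \<in> {1..d}" for k
    using that permutes_in_image[OF assms, of k] by simp
  then have "{k \<in> {1..d}. \<pi> k \<le> d} = {1..d}" by blast
  then have "iet_point (image_lengths \<mu> \<pi>) d = iet_point \<mu> d"
    using sum_image_lengths[OF assms order_refl, of \<mu>] by (simp add: iet_point_def)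
  then show ?thesis by (simp add: iet_dom_def)
qed

lemma iet_shift_eq:
  assumes "\<pi> permutes {1..d}" "j \<in> {1..d}"
  shows "iet_shift d \<mu> \<pi> j = iet_point (image_lengths \<mu> \<pi>) (\<pi> j - 1) - iet_point \<mu> (j - 1)"
proof -
  have pj: "\<pi> j \<in> {1..d}" using assms permutes_in_image by metis
  have "{k \<in> {1..d}. \<pi> k < \<pi> j} = {k \<in> {1..d}. \<pi> k \<le> \<pi> j - 1}"
    using pj by auto
  moreover have "{k \<in> {1..d}. k < j} = {1..j - 1}" using assms(2) by auto
  moreover have "\<pi> j - 1 \<le> d" using pj by auto
  ultimately show ?thesis
    using sum_image_lengths[OF assms(1), of "\<pi> j - 1" \<mu>]
    by (simp add: iet_shift_def iet_point_def)
qed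

lemma iet_map_eq:
  assumes "\<forall>j\<in>{1..d}. 0 < \<mu> j" "j \<in> {1..d}" "x \<in> iet_int \<mu> j"
  shows "iet_map d \<mu> \<pi> x = x + iet_shift d \<mu> \<pi> j"
proof -
  have "(THE j. j \<in> {1..d} \<and> x \<in> iet_int \<mu> j) = j"
    using assms iet_int_index_unique[OF assms(1)] by (intro the_equality) blast+
  then show ?thesis by (simp add: iet_map_def)
qed

text \<open>The shift moves the left end of \<open>I\<^sub>j\<close> to the left end of the \<open>\<pi> j\<close>-th interval of the
  rearranged partition, and both intervals have length \<open>\<mu> j\<close>.\<close>

lemma iet_map_image_int:
  assumes \<pi>: "\<pi> permutes {1..d}" and \<mu>: "\<forall>j\<in>{1..d}. 0 < \<mu> j" and j: "j \<in> {1..d}"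
  shows "iet_map d \<mu> \<pi> ` iet_int \<mu> j = iet_int (image_lengths \<mu> \<pi>) (\<pi> j)"
proof -
  have "\<pi> j \<in> {1..d}" using \<pi> j permutes_in_image by metis
  then have "iet_point (image_lengths \<mu> \<pi>) (\<pi> j)
      = iet_point (image_lengths \<mu> \<pi>) (\<pi> j - 1) + \<mu> j"
    using iet_point_step[of "\<pi> j" "image_lengths \<mu> \<pi>"] permutes_inverses[OF \<pi>]
    by (simp add: image_lengths_def)
  moreover have "iet_point \<mu> j = iet_point \<mu> (j - 1) + \<mu> j"
    using j by (simp add: iet_point_step)
  moreover have "iet_map d \<mu> \<pi> ` iet_int \<mu> j = (\<lambda>x. x + iet_shift d \<mu> \<pi> j) ` iet_int \<mu> j"
    using iet_map_eq[OF \<mu> j] by (intro image_cong) auto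
  then have "iet_map d \<mu> \<pi> ` iet_int \<mu> j
      = {iet_point \<mu> (j - 1) + iet_shift d \<mu> \<pi> j..<iet_point \<mu> j + iet_shift d \<mu> \<pi> j}"
    by (simp add: iet_int_def image_add_atLeastLessThan')
  ultimately show ?thesis
    by (simp add: iet_int_def iet_shift_eq[OF \<pi> j] add.commute)
qed

lemma iet_map_bij:
  assumes \<pi>: "\<pi> permutes {1..d}" and \<mu>: "\<forall>j\<in>{1..d}. 0 < \<mu> j"
  shows "bij_betw (iet_map d \<mu> \<pi>) (iet_dom d \<mu>) (iet_dom d \<mu>)"
proof -
  let ?f = "iet_map d \<mu> \<pi>" and ?\<nu> = "image_lengths \<mu> \<pi>"
  note \<nu> = image_lengths_pos[OF \<pi> \<mu>]
  have "?f ` iet_dom d \<mu> = (\<Union>j\<in>{1..d}. iet_int ?\<nu> (\<pi> j))"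
    using iet_map_image_int[OF \<pi> \<mu>] by (simp add: UN_iet_int[OF \<mu>, symmetric] image_UN)
  also have "\<dots> = (\<Union>m\<in>\<pi> ` {1..d}. iet_int ?\<nu> m)"
    by simp
  also have "\<dots> = iet_dom d \<mu>"
    using UN_iet_int[OF \<nu>] iet_dom_image_lengths[OF \<pi>] by (simp only: permutes_image[OF \<pi>])
  finally have surj: "?f ` iet_dom d \<mu> = iet_dom d \<mu>" .
  have "x = y" if xy: "x \<in> iet_dom d \<mu>" "y \<in> iet_dom d \<mu>" "?f x = ?f y" for x y
  proof -
    obtain i j where ij: "i \<in> {1..d}" "x \<in> iet_int \<mu> i" "j \<in> {1..d}" "y \<in> iet_int \<mu> j"
      using xy(1,2) unfolding UN_iet_int[OF \<mu>, symmetric] by blast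
    have "?f x \<in> iet_int ?\<nu> (\<pi> i)" "?f x \<in> iet_int ?\<nu> (\<pi> j)"
      using ij xy(3) iet_map_image_int[OF \<pi> \<mu>] by blast+
    moreover have "\<pi> i \<in> {1..d}" "\<pi> j \<in> {1..d}"
      using ij permutes_in_image[OF \<pi>] by metis+
    ultimately have "\<pi> i = \<pi> j"
      using iet_int_index_unique[OF \<nu>] by blast
    then have "i = j" using permutes_inj[OF \<pi>] by (simp add: inj_eq)
    then show ?thesis
      using xy(3) ij iet_map_eq[OF \<mu>] by simp
  qed
  then show ?thesis
    using surj by (auto simp: bij_betw_def inj_on_def)
qed

text \<open>If \<open>\<pi>\<close> fixed \<open>d\<close>, it would preserve \<open>{1..d - 1}\<close>, against irreducibility.\<close>

lemma irreducible_last_index: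
  assumes "irreducible_perm d \<pi>" "2 \<le> d"
  shows "inv \<pi> d \<in> {1..d - 1}" "\<pi> (inv \<pi> d) = d"
proof -
  have \<pi>: "\<pi> permutes {1..d}" using assms(1) by (simp add: irreducible_perm_def)
  show img: "\<pi> (inv \<pi> d) = d" by (rule permutes_inverses(1)[OF \<pi>])
  have "inv \<pi> d \<noteq> d"
  proof
    assume "inv \<pi> d = d"
    then have "\<pi> d = d" using img by simp
    have "\<pi> ` {1..d - 1} = \<pi> ` ({1..d} - {d})"
      using assms(2) by (intro arg_cong[where f = "image \<pi>"]) auto
    also have "\<dots> = \<pi> ` {1..d} - \<pi> ` {d}"
      by (rule image_set_diff[OF permutes_inj[OF \<pi>]])
    also have "\<dots> = {1..d - 1}"
      unfolding permutes_image[OF \<pi>] using \<open>\<pi> d = d\<close> assms(2) by auto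
    finally have "\<pi> ` {1..d - 1} = {1..d - 1}" .
    moreover have "1 \<le> d - 1 \<and> d - 1 < d" using assms(2) by auto
    ultimately show False using assms(1) unfolding irreducible_perm_def by blast
  qed
  moreover have "inv \<pi> d \<in> {1..d}"
    using permutes_in_image[OF permutes_inv[OF \<pi>], of d] assms(2) by simp
  ultimately show "inv \<pi> d \<in> {1..d - 1}" by auto
qed

lemma rv_type1_int_subset:
  assumes "iet_data d \<mu> \<pi>" "\<not> rv_type0 d \<mu> \<pi>"
  shows "iet_int \<mu> d \<subseteq> last_image d \<mu> \<pi>"
proof -
  have \<pi>: "\<pi> permutes {1..d}" and \<mu>: "\<forall>j\<in>{1..d}. 0 < \<mu> j"
    and a: "inv \<pi> d \<in> {1..d - 1}" "\<pi> (inv \<pi> d) = d"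
    using assms(1) irreducible_last_index by (auto simp: iet_data_def irreducible_perm_def)
  have "inv \<pi> d \<in> {1..d}" using a(1) by auto
  then have "last_image d \<mu> \<pi> = iet_int (image_lengths \<mu> \<pi>) d"
    using iet_map_image_int[OF \<pi> \<mu>] a(2) by (simp add: last_image_def)
  \<comment> \<open>Two half-open intervals with a common right end are nested.\<close>
  moreover have "iet_point (image_lengths \<mu> \<pi>) d = iet_point \<mu> d"
    using iet_dom_image_lengths[OF \<pi>, of \<mu>] iet_point_mono[OF \<mu>, of 0 d]
      iet_point_mono[OF image_lengths_pos[OF \<pi> \<mu>], of 0 d]
    by (auto simp: iet_dom_def Ico_eq_Ico)
  ultimately show ?thesis
    using assms(2) by (auto simp: rv_type0_def iet_int_def)
qed

section \<open>First returns\<close>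

lemma return_at_1: "return_at X T A z (Suc 0) \<longleftrightarrow> z \<in> X \<and> T z \<in> A"
  by (simp add: return_at_def)

lemma return_at_2: "return_at X T A z 2 \<longleftrightarrow> z \<in> X \<and> T z \<in> X \<and> T (T z) \<in> A"
  by (auto simp: return_at_def numeral_2_eq_2 less_Suc_eq)

lemma return_time_eq_1: "return_at X T A z (Suc 0) \<Longrightarrow> return_time X T A z = Suc 0"
  unfolding return_time_def by (rule Least_equality) (auto simp: return_at_def)

lemma return_time_eq_2:
  assumes "return_at X T A z 2" "T z \<notin> A"
  shows "return_time X T A z = 2"
  unfolding return_time_def
proof (rule Least_equality)
  fix n assume n: "return_at X T A z n"
  then have "n \<noteq> 0" "n \<noteq> 1" using assms(2) by (auto simp: return_at_def)
  then show "2 \<le> n" by simp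
qed (fact assms)

lemma return_time_return_at:
  assumes "\<exists>n. return_at X T A z n"
  shows "return_at X T A z (return_time X T A z)"
  using assms unfolding return_time_def by (rule LeastI_ex)

text \<open>A bijection that leaves a set \<open>H\<close> immediately after entering it: every orbit is back
  outside \<open>H\<close> after at most two steps, and the map that skips over \<open>H\<close> is still onto.\<close>

locale transient_hole =
  fixes I :: "'a set" and f :: "'a \<Rightarrow> 'a" and H :: "'a set"
  assumes bij: "bij_betw f I I" and hole: "H \<subseteq> I" and transient: "f ` H \<inter> H = {}"
begin

lemma maps_into: "x \<in> I \<Longrightarrow> f x \<in> I"
  using bij by (auto simp: bij_betw_def)

lemma return_cases:
  assumes "x \<in> I"
  shows "f x \<notin> H \<Longrightarrow> return_at I f (I - H) x (Suc 0)"
    and "f x \<in> H \<Longrightarrow> return_at I f (I - H) x 2"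
  using assms transient maps_into by (auto simp: return_at_1 return_at_2)

lemma first_return_image: "first_return I f (I - H) ` (I - H) = I - H"
proof (intro equalityI subsetI)
  fix y assume "y \<in> first_return I f (I - H) ` (I - H)"
  then obtain x where x: "x \<in> I - H" and y: "y = (f ^^ return_time I f (I - H) x) x"
    by (auto simp: first_return_def)
  then have "return_at I f (I - H) x (return_time I f (I - H) x)"
    using return_cases[of x] by (intro return_time_return_at) blast
  then show "y \<in> I - H" by (simp add: y return_at_def)
next
  fix y assume y: "y \<in> I - H"
  then have "y \<in> f ` I" using bij by (simp add: bij_betw_def)
  then obtain x where x: "x \<in> I" "f x = y" by blast
  show "y \<in> first_return I f (I - H) ` (I - H)"
  proof (cases "x \<in> H")
    case False
    then have "first_return I f (I - H) x = y"
      using return_time_eq_1[of I f "I - H" x] x y by (simp add: return_at_1 first_return_def)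
    then show ?thesis using x False by auto
  next
    case True
    \<comment> \<open>The point reached from inside the hole is hit by the point that jumped into the hole.\<close>
    have "x \<in> f ` I" using x bij by (simp add: bij_betw_def)
    then obtain w where w: "w \<in> I" "f w = x" by blast
    then have "w \<notin> H" using True transient by auto
    have "return_time I f (I - H) w = 2"
      using return_cases(2)[of w] w True by (intro return_time_eq_2) auto
    then have "first_return I f (I - H) w = y"
      using w x by (simp add: first_return_def numeral_2_eq_2)
    then show ?thesis using w \<open>w \<notin> H\<close> by auto
  qed
qed

end

section \<open>Conjugacies and first returns\<close>

text \<open>The last assumption, full invariance under preimages, is what makes it possible to follow a
  \<open>T\<close>-orbit backwards from \<open>h ` I\<close>; the other ones only control forward orbits.\<close>

locale invariant_embedding =
  fixes I :: "'a set" and f :: "'a \<Rightarrow> 'a" and X :: "'b set" and T :: "'b \<Rightarrow> 'b" and h :: "'a \<Rightarrow> 'b"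
  assumes inj: "inj_on h I" and into: "h ` I \<subseteq> X" and maps: "f ` I \<subseteq> I"
    and conj: "x \<in> I \<Longrightarrow> h (f x) = T (h x)"
    and preimage: "\<lbrakk>z \<in> X; T z \<in> h ` I\<rbrakk> \<Longrightarrow> z \<in> h ` I"
begin

lemma funpow_conj:
  assumes "x \<in> I"
  shows "(f ^^ n) x \<in> I" "(T ^^ n) (h x) = h ((f ^^ n) x)"
proof -
  have "(f ^^ n) x \<in> I \<and> (T ^^ n) (h x) = h ((f ^^ n) x)"
    using assms maps by (induction n) (auto simp: conj)
  then show "(f ^^ n) x \<in> I" "(T ^^ n) (h x) = h ((f ^^ n) x)" by auto
qed

lemma return_at_conj:
  assumes "\<And>x. x \<in> I \<Longrightarrow> h x \<in> A' \<longleftrightarrow> x \<in> A" "x \<in> I"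
  shows "return_at X T A' (h x) = return_at I f A x"
  using funpow_conj[OF assms(2)] assms(1) into by (auto simp: return_at_def fun_eq_iff)

lemma return_time_conj:
  assumes "\<And>x. x \<in> I \<Longrightarrow> h x \<in> A' \<longleftrightarrow> x \<in> A" "x \<in> I"
  shows "return_time X T A' (h x) = return_time I f A x"
  by (simp add: return_time_def return_at_conj[OF assms])

lemma first_return_conj:
  assumes "\<And>x. x \<in> I \<Longrightarrow> h x \<in> A' \<longleftrightarrow> x \<in> A" "x \<in> I"
  shows "first_return X T A' (h x) = h (first_return I f A x)"
  by (simp add: first_return_def return_time_conj[OF assms] funpow_conj[OF assms(2)])

lemma funpow_preimage:
  assumes "\<forall>k<n. (T ^^ k) z \<in> X" "(T ^^ n) z \<in> h ` I"
  shows "z \<in> h ` I"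
  using assms
proof (induction n)
  case (Suc n)
  then have "(T ^^ n) z \<in> h ` I" using preimage[of "(T ^^ n) z"] by simp
  then show ?case using Suc by simp
qed simp

text \<open>An excursion of \<open>T\<close> that ends in \<open>h ` A\<close> runs inside \<open>h ` I\<close> from the start, so no
  point of the domain of the induced map outside \<open>h ` A\<close> returns to \<open>h ` A\<close>.\<close>

lemma invariant_set_first_return:
  assumes mem: "\<And>x. x \<in> I \<Longrightarrow> h x \<in> A' \<longleftrightarrow> x \<in> A" and "A \<subseteq> I"
    and returns: "\<And>x. x \<in> A \<Longrightarrow> \<exists>n. return_at I f A x n"
    and surj: "first_return I f A ` A = A"
  shows "h ` A \<subseteq> return_dom X T A'"
    and "invariant_set (return_dom X T A') (first_return X T A') (h ` A)"
proof -
  have S: "first_return X T A' (h x) = h (first_return I f A x)" if "x \<in> A" for x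
    using that \<open>A \<subseteq> I\<close> first_return_conj[of A' A x] mem by blast
  show sub: "h ` A \<subseteq> return_dom X T A'"
  proof clarify
    fix x assume x: "x \<in> A"
    then have "return_at X T A' (h x) = return_at I f A x"
      using \<open>A \<subseteq> I\<close> by (intro return_at_conj[OF mem]) auto
    then show "h x \<in> return_dom X T A'"
      using x returns[of x] mem[of x] \<open>A \<subseteq> I\<close> by (auto simp: return_dom_def)
  qed
  have "first_return X T A' ` h ` A = h ` first_return I f A ` A"
    using S by (simp add: image_image)
  then have image: "first_return X T A' ` h ` A = h ` A" by (simp add: surj)
  have "z \<in> h ` A" if z: "z \<in> return_dom X T A'" "first_return X T A' z \<in> h ` A" for z
  proof -
    have "return_at X T A' z (return_time X T A' z)"
      using z(1) by (intro return_time_return_at) (simp add: return_dom_def)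
    then have "z \<in> h ` I"
      using z(2) \<open>A \<subseteq> I\<close> funpow_preimage[of "return_time X T A' z" z]
      by (auto simp: return_at_def first_return_def)
    then show ?thesis using z(1) mem by (auto simp: return_dom_def)
  qed
  then show "invariant_set (return_dom X T A') (first_return X T A') (h ` A)"
    using image sub unfolding invariant_set_def by blast
qed

end

section \<open>The induced exchange inside the induced isometry\<close>

locale embedded_iet =
  fixes d :: nat and \<mu> :: "nat \<Rightarrow> real" and \<pi> :: "nat \<Rightarrow> nat"
    and X :: "complex set" and Xs :: "nat \<Rightarrow> complex set" and T :: "complex \<Rightarrow> complex"
    and h :: "real \<Rightarrow> complex"
  assumes data: "iet_data d \<mu> \<pi>" and pwi: "pwi d X Xs T"
    and neq: "iet_int \<mu> d \<noteq> last_image d \<mu> \<pi>"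
    and emb: "cont_embedding d (iet_dom d \<mu>) (iet_int \<mu>) (iet_map d \<mu> \<pi>) X Xs T h"
begin

abbreviation "I \<equiv> iet_dom d \<mu>"
abbreviation "J \<equiv> iet_int \<mu>"
abbreviation "f \<equiv> iet_map d \<mu> \<pi>"
abbreviation "a \<equiv> last_index d \<pi>"
abbreviation "I' \<equiv> rv_dom d \<mu> \<pi>"
abbreviation "J' \<equiv> rv_int d \<mu> \<pi>"
abbreviation "X' \<equiv> pwi_ind_set d \<mu> \<pi> Xs T"

lemma perm: "\<pi> permutes {1..d}" and pos: "\<forall>j\<in>{1..d}. 0 < \<mu> j" and two: "2 \<le> d"
  using data by (auto simp: iet_data_def irreducible_perm_def)

lemma a_range: "1 \<le> a" "a < d" "a \<in> {1..d}" "d \<in> {1..d}"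
  using irreducible_last_index(1)[of d \<pi>] data two by (auto simp: iet_data_def)

lemma f_inj: "\<lbrakk>x \<in> I; y \<in> I; f x = f y\<rbrakk> \<Longrightarrow> x = y"
  using iet_map_bij[OF perm pos] by (auto simp: bij_betw_def inj_on_def)

lemma J_subset: "j \<in> {1..d} \<Longrightarrow> J j \<subseteq> I"
  using UN_iet_int[OF pos] by blast

lemma J_cover: "x \<in> I \<Longrightarrow> \<exists>j\<in>{1..d}. x \<in> J j"
  using UN_iet_int[OF pos] by blast

lemma J_disjoint: "\<lbrakk>i \<in> {1..d}; j \<in> {1..d}; i \<noteq> j; x \<in> J i\<rbrakk> \<Longrightarrow> x \<notin> J j"
  using iet_int_index_unique[OF pos, of i j x] by auto

lemma X_unique: "\<lbrakk>i \<in> {1..d}; j \<in> {1..d}; z \<in> Xs i; z \<in> Xs j\<rbrakk> \<Longrightarrow> i = j"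
  using pwi unfolding pwi_def disjoint_family_on_def by blast

lemma h_J: "\<lbrakk>j \<in> {1..d}; x \<in> J j\<rbrakk> \<Longrightarrow> h x \<in> Xs j"
  using emb unfolding cont_embedding_def pw_cont_embedding_def by blast

lemma mem_J_iff: "\<lbrakk>j \<in> {1..d}; x \<in> I\<rbrakk> \<Longrightarrow> h x \<in> Xs j \<longleftrightarrow> x \<in> J j"
  by (metis J_cover X_unique h_J)

lemma f_mem_last_image_iff: "x \<in> I \<Longrightarrow> f x \<in> last_image d \<mu> \<pi> \<longleftrightarrow> x \<in> J a"
  using J_subset[OF a_range(3)] f_inj by (auto simp: last_image_def)

sublocale invariant_embedding I f X T h
proof
  show "f ` I \<subseteq> I" using iet_map_bij[OF perm pos] by (simp add: bij_betw_def)
qed (use emb in \<open>auto simp: cont_embedding_def pw_cont_embedding_def invariant_set_def\<close>)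

subsection \<open>The removed set\<close>

definition hole :: "real set" where
  "hole = (if rv_type0 d \<mu> \<pi> then last_image d \<mu> \<pi> else J d)"

lemma rv_dom_eq: "I' = I - hole"
  by (simp add: hole_def rv_dom_def)

lemma hole_subset: "hole \<subseteq> J d" "hole \<subseteq> last_image d \<mu> \<pi>"
  using rv_type1_int_subset[OF data] by (auto simp: hole_def rv_type0_def)

lemma J_hole: "\<lbrakk>j \<in> {1..d}; x \<in> J j; j \<noteq> d\<rbrakk> \<Longrightarrow> x \<notin> hole"
  using hole_subset(1) J_disjoint[of j d x] a_range(4) by auto

lemma f_hole_imp_J_a: "\<lbrakk>x \<in> I; f x \<in> hole\<rbrakk> \<Longrightarrow> x \<in> J a"
  using hole_subset(2) f_mem_last_image_iff by blast

text \<open>A point of the hole lies in \<open>I\<^sub>d\<close>, while a point mapped into the hole lies in \<open>I\<^sub>a\<close>; since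
  \<open>a \<noteq> d\<close>, no point does both.\<close>

sublocale transient_hole I f hole
proof
  show "bij_betw f I I" by (rule iet_map_bij[OF perm pos])
  show sub: "hole \<subseteq> I" using hole_subset(1) J_subset[OF a_range(4)] by blast
  show "f ` hole \<inter> hole = {}"
  proof -
    have "f x \<notin> hole" if "x \<in> hole" for x
      using that sub f_hole_imp_J_a[of x] J_hole[OF a_range(3), of x] a_range(2) by auto
    then show ?thesis by blast
  qed
qed

text \<open>For type 0, a point \<open>h x\<close> in \<open>T ` X\<^sub>a\<close> is \<open>T z\<close> with \<open>z\<close> in \<open>X\<^sub>a\<close>; invariance under preimages
  turns \<open>z\<close> into \<open>h y\<close> with \<open>y\<close> in \<open>I\<^sub>a\<close>, and injectivity of \<open>h\<close> gives \<open>x = f y\<close>.\<close>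

lemma embedding_mem_T_image_iff:
  assumes "x \<in> I"
  shows "h x \<in> T ` Xs a \<longleftrightarrow> x \<in> last_image d \<mu> \<pi>"
proof
  assume "h x \<in> T ` Xs a"
  then obtain z where z: "z \<in> Xs a" "h x = T z" by auto
  moreover have "z \<in> X" using z(1) a_range(3) pwi unfolding pwi_def by blast
  ultimately obtain y where y: "y \<in> I" "z = h y"
    using preimage[of z] assms by (metis image_iff)
  then have "y \<in> J a" using mem_J_iff[OF a_range(3)] z(1) by simp
  moreover have "x = f y"
  proof (rule inj_onD[OF inj _ assms maps_into[OF y(1)]])
    show "h x = h (f y)" by (simp only: z(2) y(2) conj[OF y(1)])
  qed
  ultimately show "x \<in> last_image d \<mu> \<pi>" by (simp add: last_image_def)
next
  assume "x \<in> last_image d \<mu> \<pi>"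
  then obtain y where y: "y \<in> J a" "x = f y" by (auto simp: last_image_def)
  then have "h x = T (h y)" using J_subset[OF a_range(3)] conj by blast
  then show "h x \<in> T ` Xs a" using h_J[OF a_range(3) y(1)] by simp
qed

lemma embedding_mem_ind_set_iff:
  assumes "x \<in> I"
  shows "h x \<in> X' \<longleftrightarrow> x \<in> I'"
proof -
  obtain j where j: "j \<in> {1..d}" "x \<in> J j" using J_cover[OF assms] by blast
  have low: "h x \<in> (\<Union>i\<in>{1..d - 1}. Xs i) \<longleftrightarrow> j \<noteq> d"
  proof
    assume "h x \<in> (\<Union>i\<in>{1..d - 1}. Xs i)"
    then obtain i where "i \<in> {1..d - 1}" "h x \<in> Xs i" by blast
    moreover from this have "i = j" by (intro X_unique[OF _ j(1) _ h_J[OF j]]) auto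
    ultimately show "j \<noteq> d" using two by auto
  next
    assume "j \<noteq> d"
    then have "j \<in> {1..d - 1}" using j(1) by auto
    then show "h x \<in> (\<Union>i\<in>{1..d - 1}. Xs i)" using h_J[OF j] by blast
  qed
  have X': "h x \<in> X' \<longleftrightarrow> j \<noteq> d \<or> rv_type0 d \<mu> \<pi> \<and> h x \<in> Xs d \<and> h x \<notin> T ` Xs a"
    unfolding pwi_ind_set_def using low by (cases "rv_type0 d \<mu> \<pi>") simp_all
  show ?thesis
  proof (cases "j = d")
    case True
    then have "h x \<in> Xs d" "x \<in> J d" using j h_J by auto
    then show ?thesis
      using X' True assms embedding_mem_T_image_iff[OF assms] by (simp add: rv_dom_eq hole_def)
  next
    case False
    then have "x \<in> I'" using J_hole[OF j] assms by (simp add: rv_dom_eq)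
    then show ?thesis using X' False by simp
  qed
qed

subsection \<open>Itineraries\<close>

lemma itinerary_length_1:
  assumes "i \<in> {1..d}" "x \<in> J i" "x \<in> I'" "f x \<notin> hole"
  shows "h x \<in> itinerary_piece X Xs T X' [i]"
proof -
  have x: "x \<in> I" using assms(3) by (simp add: rv_dom_eq)
  then have "return_at X T X' (h x) (Suc 0)"
    using return_cases(1)[of x] assms(4) return_at_conj[OF embedding_mem_ind_set_iff x]
    by (simp add: rv_dom_eq)
  then show ?thesis
    using h_J[OF assms(1,2)] embedding_mem_ind_set_iff[OF x] assms(3) return_time_eq_1
    by (auto simp: itinerary_piece_def return_dom_def)
qed

lemma itinerary_length_2:
  assumes "x \<in> I'" "f x \<in> hole"
  shows "h x \<in> itinerary_piece X Xs T X' [a, d]"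
proof -
  have x: "x \<in> I" using assms(1) by (simp add: rv_dom_eq)
  have fx: "f x \<in> J d" "f x \<in> I" using assms(2) hole_subset(1) maps_into[OF x] by auto
  have ret: "return_at X T X' (h x) 2"
    using return_cases(2)[of x] assms(2) x return_at_conj[OF embedding_mem_ind_set_iff x]
    by (simp add: rv_dom_eq)
  have "T (h x) \<notin> X'"
    using embedding_mem_ind_set_iff[OF fx(2)] assms(2) conj[OF x] by (simp add: rv_dom_eq)
  then have "return_time X T X' (h x) = 2" by (rule return_time_eq_2[OF ret])
  moreover have "h x \<in> return_dom X T X'"
    using ret assms(1) embedding_mem_ind_set_iff[OF x] by (auto simp: return_dom_def)
  moreover have "h x \<in> Xs a" "T (h x) \<in> Xs d"
    using h_J[OF a_range(3) f_hole_imp_J_a[OF x assms(2)]] h_J[OF a_range(4) fx(1)] conj[OF x]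
    by simp_all
  ultimately show ?thesis
    by (auto simp: itinerary_piece_def numeral_2_eq_2 less_Suc_eq)
qed

text \<open>The long itinerary starts only in \<open>I\<^sub>a\<close>.  For type 0 the whole of \<open>I\<^sub>a\<close> is mapped into the hole;
  for type 1 only a part of it is, and the induction splits \<open>I\<^sub>a\<close> at exactly that place.  The
  pieces are nonempty because the two competing intervals are nested but distinct.\<close>

lemma rv_int_cases:
  assumes "j \<in> {1..d}"
  obtains (short) i where "i \<in> {1..d}" "J' j \<subseteq> J i" "J' j \<subseteq> I'" "J' j \<noteq> {}"
      "\<And>x. x \<in> J' j \<Longrightarrow> f x \<notin> hole"
    | (long) "J' j \<subseteq> J a" "J' j \<subseteq> I'" "J' j \<noteq> {}" "\<And>x. x \<in> J' j \<Longrightarrow> f x \<in> hole"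
proof -
  \<comment> \<open>Points enter the hole only from \<open>I\<^sub>a\<close>, and only \<open>I\<^sub>d\<close> loses points to it.\<close>
  have unchanged: "J i \<subseteq> I'" "J i \<noteq> {}" "x \<in> J i \<Longrightarrow> f x \<notin> hole"
    if i: "i \<in> {1..d}" "i \<noteq> a" "i \<noteq> d" for i x
  proof -
    show "J i \<subseteq> I'" using J_hole[OF i(1) _ i(3)] J_subset[OF i(1)] by (auto simp: rv_dom_eq)
    show "J i \<noteq> {}" by (rule iet_int_nonempty[OF pos i(1)])
    show "f x \<notin> hole" if "x \<in> J i"
      using that J_disjoint[OF i(1) a_range(3) i(2)] J_subset[OF i(1)] f_hole_imp_J_a by blast
  qed
  have "a \<noteq> d" using a_range(2) by simp
  then have Ja: "J a \<subseteq> I'" "J a \<noteq> {}"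
    using J_hole[OF a_range(3)] J_subset[OF a_range(3)] iet_int_nonempty[OF pos a_range(3)]
    by (auto simp: rv_dom_eq)
  have Jd: "f x \<notin> hole" if "x \<in> J d" for x
    using that J_disjoint[OF a_range(4,3) not_sym[OF \<open>a \<noteq> d\<close>]] J_subset[OF a_range(4)]
      f_hole_imp_J_a by blast
  show thesis
  proof (cases "rv_type0 d \<mu> \<pi>")
    case type0: True
    then have hole: "hole = last_image d \<mu> \<pi>" by (simp add: hole_def)
    consider "j = a" | "j = d" "j \<noteq> a" | "j \<noteq> a" "j \<noteq> d" by blast
    then show thesis
    proof cases
      case 1
      then have "J' j = J a" using type0 a_range by (simp add: rv_int_def)
      then show thesis
        using Ja f_mem_last_image_iff J_subset[OF a_range(3)] hole by (intro long) auto
    next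
      case 2
      then have J': "J' j = J d - hole" using type0 hole by (simp add: rv_int_def)
      moreover have "\<not> J d \<subseteq> hole" using neq hole hole_subset(1) by blast
      ultimately show thesis
        using Jd J_subset[OF a_range(4)] a_range(4)
        by (intro short[of d]) (auto simp: rv_dom_eq)
    next
      case 3
      then have "J' j = J j" using type0 by (simp add: rv_int_def)
      then show thesis using unchanged[OF assms] 3 assms by (intro short[of j]) auto
    qed
  next
    case type1: False
    define B where "B = {x \<in> I. f x \<in> J d}"
    have hole: "hole = J d" using type1 by (simp add: hole_def)
    have J': "J' j = (if j < a then J j else if j = a then J a - B
        else if j = a + 1 then B else J (j - 1))"
      using type1 by (simp add: rv_int_def B_def)
    have B: "B \<subseteq> J a" using f_hole_imp_J_a hole by (auto simp: B_def)
    consider "j < a" | "j = a" | "j = a + 1" | "j > a + 1" by linarith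
    then show thesis
    proof cases
      case 1
      then show thesis
        using unchanged[OF assms] J' assms a_range(2) by (intro short[of j]) auto
    next
      case 2
      obtain y where "y \<in> last_image d \<mu> \<pi>" "y \<notin> J d"
        using type1 by (auto simp: rv_type0_def)
      then have "J a - B \<noteq> {}" by (auto simp: last_image_def B_def)
      moreover have "f x \<notin> hole" if "x \<in> J a - B" for x
        using that J_subset[OF a_range(3)] hole by (auto simp: B_def)
      ultimately show thesis
        using Ja J' 2 a_range(3) by (intro short[of a]) auto
    next
      case 3
      obtain y where "y \<in> J d" using iet_int_nonempty[OF pos a_range(4)] by blast
      then have "y \<in> f ` J a" using hole_subset(2) hole by (auto simp: last_image_def)
      then have "B \<noteq> {}" using \<open>y \<in> J d\<close> J_subset[OF a_range(3)] by (auto simp: B_def)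
      then show thesis
        using B Ja J' 3 hole by (intro long) (auto simp: B_def)
    next
      case 4
      then have "j - 1 \<in> {1..d}" "j - 1 \<noteq> a" "j - 1 \<noteq> d" using assms by auto
      then show thesis
        using unchanged[of "j - 1"] J' 4 by (intro short[of "j - 1"]) auto
    qed
  qed
qed

lemma rv_int_atom:
  assumes "j \<in> {1..d}"
  shows "\<exists>A \<in> return_atoms d X Xs T X'. h ` J' j \<subseteq> A"
proof -
  have *: ?thesis if "set w \<subseteq> {1..d}" "J' j \<noteq> {}" "h ` J' j \<subseteq> itinerary_piece X Xs T X' w" for w
    using that unfolding return_atoms_def by blast
  from assms show ?thesis
  proof (cases rule: rv_int_cases)
    case (short i)
    then have "h ` J' j \<subseteq> itinerary_piece X Xs T X' [i]"
      using itinerary_length_1[of i] by blast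
    then show ?thesis using short by (intro *[of "[i]"]) auto
  next
    case long
    then have "h ` J' j \<subseteq> itinerary_piece X Xs T X' [a, d]"
      using itinerary_length_2 by blast
    then show ?thesis using long a_range by (intro *[of "[a, d]"]) auto
  qed
qed

lemma rv_int_homeomorphism:
  assumes "j \<in> {1..d}"
  shows "\<exists>k. homeomorphism (J' j) (h ` J' j) h k"
proof -
  obtain i where i: "i \<in> {1..d}" "J' j \<subseteq> J i"
    using assms by (rule rv_int_cases) (use a_range(3) in blast)+
  obtain k where "homeomorphism (J i) (h ` J i) h k"
    using emb i(1) unfolding cont_embedding_def pw_cont_embedding_def by blast
  then show ?thesis
    using i(2) by (meson homeomorphism_of_subsets image_mono order_refl)
qed

lemma rv_cont_embedding:
  "\<exists>As. (\<forall>j\<in>{1..d}. As j \<in> return_atoms d X Xs T X') \<and>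
     cont_embedding d I' J' (rv_map d \<mu> \<pi>) (return_dom X T X') As (first_return X T X') h"
proof -
  obtain As where As: "\<forall>j\<in>{1..d}. As j \<in> return_atoms d X Xs T X' \<and> h ` J' j \<subseteq> As j"
    using rv_int_atom bchoice[of "{1..d}" "\<lambda>j A. A \<in> return_atoms d X Xs T X' \<and> h ` J' j \<subseteq> A"]
    by blast
  have sub: "I' \<subseteq> I" by (auto simp: rv_dom_eq)
  have returns: "\<exists>n. return_at I f I' x n" if "x \<in> I'" for x
    using return_cases[of x] that unfolding rv_dom_eq by blast
  have surj: "first_return I f I' ` I' = I'"
    unfolding rv_dom_eq by (rule first_return_image)
  note inv = invariant_set_first_return[OF embedding_mem_ind_set_iff sub returns surj]
  have "\<forall>x\<in>I'. h (rv_map d \<mu> \<pi> x) = first_return X T X' (h x)"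
    using first_return_conj[OF embedding_mem_ind_set_iff] sub by (auto simp: rv_map_def)
  moreover have "inj_on h I'" using inj sub by (rule inj_on_subset)
  moreover have "continuous_on I' h"
    using emb sub unfolding cont_embedding_def by (blast intro: continuous_on_subset)
  ultimately have "cont_embedding d I' J' (rv_map d \<mu> \<pi>) (return_dom X T X') As
      (first_return X T X') h"
    using As rv_int_homeomorphism inv by (simp add: cont_embedding_def pw_cont_embedding_def)
  then show ?thesis using As by blast
qed

end

section \<open>Rauzy--Veech induction preserves continuous embeddings\<close>

theorem theorem2p3:
  fixes d :: nat and \<mu> :: "nat \<Rightarrow> real" and \<pi> :: "nat \<Rightarrow> nat"
    and X :: "complex set" and Xs :: "nat \<Rightarrow> complex set" and T :: "complex \<Rightarrow> complex"
    and h :: "real \<Rightarrow> complex"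
  defines "X' \<equiv> pwi_ind_set d \<mu> \<pi> Xs T"
  assumes "iet_data d \<mu> \<pi>"
    and "pwi d X Xs T"
    and "iet_int \<mu> d \<noteq> iet_map d \<mu> \<pi> ` iet_int \<mu> (inv \<pi> d)"
    and "cont_embedding d (iet_dom d \<mu>) (iet_int \<mu>) (iet_map d \<mu> \<pi>) X Xs T h"
  shows "\<exists>As. (\<forall>j\<in>{1..d}. As j \<in> return_atoms d X Xs T X') \<and>
           cont_embedding d (rv_dom d \<mu> \<pi>) (rv_int d \<mu> \<pi>) (rv_map d \<mu> \<pi>)
             (return_dom X T X') As (first_return X T X') h"
proof -
  interpret embedded_iet d \<mu> \<pi> X Xs T h
    using assms(2-) by unfold_locales (simp_all add: last_image_def)
  show ?thesis
    unfolding X'_def by (rule rv_cont_embedding)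
qed

end
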